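(* Consider the two-dimensional moving-mesh semi-discrete finite volume scheme (T1)–(T5) given in the context, for the cell averages $\overline{J\boldsymbol U}_{i,j},\ \overline J_{i,j},\ \overline{J\boldsymbol w}_{i,j},\ \overline{J\boldsymbol q}_{i,j}$. The scheme is well-balanced in the following sense. Let it be discretized in time by the forward Euler method or by an explicit strong-stability-preserving (SSP) Runge–Kutta method (the same method being applied to all evolution equations), and let $C\in\mathbb R$ be a constant. If a steady state is reached at the $n$th time level $t^n$, i.e. $$\overline{\boldsymbol U}_{i,j}^{\,n}+\overline{\boldsymbol w}_{i,j}^{\,n}=C\,\overline{\boldsymbol q}_{i,j}^{\,n}\qquad\forall i,j,$$ then the numerical solution at $t^{n+1}$ also satisfies $$\overline{\boldsymbol U}_{i,j}^{\,n+1}+\overline{\boldsymbol w}_{i,j}^{\,n+1}=C\,\overline{\boldsymbol q}_{i,j}^{\,n+1}\qquad\forall i,j.$$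
   Context: **Equations.** 2D shallow water equations with depth $h\ge0$, velocity $\boldsymbol v=(v_1,v_2)$, gravity constant $g>0$, time-independent bottom $b$. $\boldsymbol U=(h,hv_1,hv_2)^\top$, $\boldsymbol F_1=(hv_1,hv_1^2+\frac12gh^2,hv_1v_2)^\top$, $\boldsymbol F_2=(hv_2,hv_1v_2,hv_2^2+\frac12gh^2)^\top$, $\boldsymbol w=(b,0,0)^\top$, $\boldsymbol q=(1,0,0)^\top$. The source $(0,-ghb_{x_1},-ghb_{x_2})^\top$ is decomposed as $\sum_{m=1}^2 s_m\big(\partial_{x_1}\boldsymbol r_{m1}+\partial_{x_2}\boldsymbol r_{m2}\big)$ with $s_1=-g(h+b)$, $s_2=\frac12g$, $\boldsymbol r_{11}=(0,b,0)^\top$, $\boldsymbol r_{12}=(0,0,b)^\top$, $\boldsymbol r_{21}=(0,b^2,0)^\top$, $\boldsymbol r_{22}=(0,0,b^2)^\top$; $\boldsymbol r_m=(\boldsymbol r_{m1},\boldsymbol r_{m2})$. For a 2-vector $\boldsymbol n$ and a pair $\boldsymbol A=(\boldsymbol A_1,\boldsymbol A_2)$ of vectors in $\mathbb R^3$, $\langle\boldsymbol n,\boldsymbol A\rangle=n_1\boldsymbol A_1+n_2\boldsymbol A_2$. **Mesh.** Uniform computational cells $I_{i,j}=[(\xi_1)_{i-1/2},(\xi_1)_{i+1/2}]\times[(\xi_2)_{j-1/2},(\xi_2)_{j+1/2}]$ of size $\Delta\xi_1\times\Delta\xi_2$; values outside the domain are supplied by boundary conditions (ghost cells), and "for all $i,j$"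 includes these. $J$ is the Jacobian determinant of the moving-mesh map from computational to physical space; all $\overline J_{i,j}$ are assumed positive. $\overline{\boldsymbol U}_{i,j}=\overline{J\boldsymbol U}_{i,j}/\overline J_{i,j}$, and likewise for $\boldsymbol w,\boldsymbol q$. **Quadrature and reconstruction.** $\omega_1,\dots,\omega_Q$ ($\sum_\mu\omega_\mu=1$, $Q=4$) are the Gauss–Lobatto weights and $\omega_{\mu,\nu}=\omega_\mu\omega_\nu$. A subscript $i_\mu,j_\nu$ denotes a value at the tensor-product Gauss–Lobatto node $((\xi_1)_{i_\mu},(\xi_2)_{j_\nu})$ of $I_{i,j}$; a superscript $\mu$ with subscript $i\pm\frac12,j$ (resp. $i,j\pm\frac12$) denotes a value at $((\xi_1)_{i\pm1/2},(\xi_2)_{j_\mu})$ (resp. $((\xi_1)_{i_\mu},(\xi_2)_{j\pm1/2})$). A (fifth-order WENO-based) reconstruction followed by a positivity limiter gives point values $J_{i_\mu,j_\nu}>0$, $\boldsymbol U_{i_\mu,j_\nu}$ with $h_{i_\mu,j_\nu}\ge0$, $\boldsymbol w_{i_\mu,j_\nu}=(b_{i_\mu,j_\nu},0,0)^\top$, $\boldsymbol q_{i_\mu,j_\nu}$. Traces of each reconstructed quantity $u$: $u^{-,\mu}_{i+1/2,j}=u_{i_Q,j_\mu}$, $u^{+,\mu}_{i-1/2,j}=u_{i_1,j_\mu}$, $u^{-,\mu}_{i,j+1/2}=u_{i_\mu,j_Q}$, $u^{+,\mu}_{i,j-1/2}=u_{i_\mu,j_1}$. In every time step and every Runge–Kutta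 stage: (i) $\sum_{\mu,\nu}\omega_{\mu,\nu}J_{i_\mu,j_\nu}=\overline J_{i,j}$ and $\sum_{\mu,\nu}\omega_{\mu,\nu}J_{i_\mu,j_\nu}\boldsymbol U_{i_\mu,j_\nu}=\overline{J\boldsymbol U}_{i,j}$; (ii) if $\overline{\boldsymbol U}_{i,j}+\overline{\boldsymbol w}_{i,j}=C\overline{\boldsymbol q}_{i,j}$ for all $i,j$, then $\boldsymbol U_{i_\mu,j_\nu}+\boldsymbol w_{i_\mu,j_\nu}=C\boldsymbol q_{i_\mu,j_\nu}$ at all nodes (in particular $hv_1=hv_2=0$ there); (iii) $\boldsymbol q$ is initialized as $(1,0,0)^\top$ and constants are reproduced, so $\boldsymbol q_{i_\mu,j_\nu}=(1,0,0)^\top$ at all times. Point velocities: $v_\ell=(hv_\ell)/h$ if $h>10^{-4}$ and $v_\ell=\sqrt2\,h(hv_\ell)/\sqrt{h^4+\max\{h^4,(\Delta\xi_1\Delta\xi_2)^2\}}$ otherwise (so $v_\ell=0$ whenever $hv_\ell=0$). **Notation.** $\{\!\{u\}\!\}=\frac12(u^++u^-)$, $[\![u]\!]=u^+-u^-$ at each interface node. The discrete spatial metrics $(J\partial\xi_1/\partial x_k)^\mu_{i\pm1/2,j}$, $(J\partial\xi_2/\partial x_k)^\mu_{i,j\pm1/2}$ ($k=1,2$) are given, single-valued at the interface nodes, and satisfy the discrete surface conservation laws (T3). At interface nodes, $$L_\ell=\Big(\sum_{k=1}^2\big(J\tfrac{\partial\xi_\ell}{\partial x_k}\big)^2\Big)^{1/2},\qquad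 \boldsymbol n_\ell=\frac1{L_\ell}\big(J\tfrac{\partial\xi_\ell}{\partial x_1},J\tfrac{\partial\xi_\ell}{\partial x_2}\big)^\top .$$ Temporal metrics: $\widehat{J\partial\xi_\ell/\partial t}=-\sum_k(\partial x_k/\partial t)(J\partial\xi_\ell/\partial x_k)$ at interface nodes, with given mesh velocity $\partial x_k/\partial t$, and $$\big(J\tfrac{\partial\xi_1}{\partial t}\big)^\mu_{i\pm\frac12,j}=\big(\widehat{J\tfrac{\partial\xi_1}{\partial t}}\big)^\mu_{i\pm\frac12,j}-\tfrac{(\beta_1)_J}2[\![J]\!]^\mu_{i\pm\frac12,j},\qquad \big(J\tfrac{\partial\xi_2}{\partial t}\big)^\mu_{i,j\pm\frac12}=\big(\widehat{J\tfrac{\partial\xi_2}{\partial t}}\big)^\mu_{i,j\pm\frac12}-\tfrac{(\beta_2)_J}2[\![J]\!]^\mu_{i,j\pm\frac12},$$ where $\alpha_1=\max_{i,j,\mu}|(J\frac{\partial\xi_1}{\partial t})^\mu_{i\pm\frac12,j}|$, $\alpha_2=\max_{i,j,\mu}|(J\frac{\partial\xi_2}{\partial t})^\mu_{i,j\pm\frac12}|$, $(\beta_1)_J=\max_{i,j,\mu}|(\widehat{J\frac{\partial\xi_1}{\partial t}}/J)^\mu_{i\pm\frac12,j}|$, $(\beta_2)_J=\max_{i,j,\mu}|(\widehat{J\frac{\partial\xi_2}{\partial t}}/J)^\mu_{i,j\pm\frac12}|$, $\beta=\max_{i,j}(|\overline{\boldsymbol v}_{i,j}|+\sqrt{g\overline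 h_{i,j}})$ ($\overline{\boldsymbol v}_{i,j}$ the velocity of $\overline{\boldsymbol U}_{i,j}$). $(\overline s_1)_{i,j}=-g(\overline h_{i,j}+\overline b_{i,j})$, $(\overline s_2)_{i,j}=\frac12g$, and $(s_m)_{i_\mu,j_\nu}$ are the point values. **Scheme.** (T1) $\displaystyle \frac{d\,\overline{J\boldsymbol U}_{i,j}}{dt}=-\tfrac1{\Delta\xi_1}\big((\widetilde{\boldsymbol{\mathcal F}}_1)_{i+\frac12,j}-(\widetilde{\boldsymbol{\mathcal F}}_1)_{i-\frac12,j}\big)+\tfrac1{\Delta\xi_1}\sum_{m=1}^2(\overline s_m)_{i,j}\big((\widetilde{\boldsymbol{\mathcal R}}_{m1})_{i+\frac12,j}-(\widetilde{\boldsymbol{\mathcal R}}_{m1})_{i-\frac12,j}\big)$ $\displaystyle -\tfrac1{\Delta\xi_2}\big((\widetilde{\boldsymbol{\mathcal F}}_2)_{i,j+\frac12}-(\widetilde{\boldsymbol{\mathcal F}}_2)_{i,j-\frac12}\big)+\tfrac1{\Delta\xi_2}\sum_{m=1}^2(\overline s_m)_{i,j}\big((\widetilde{\boldsymbol{\mathcal R}}_{m2})_{i,j+\frac12}-(\widetilde{\boldsymbol{\mathcal R}}_{m2})_{i,j-\frac12}\big)+\sum_{\mu,\nu}\omega_{\mu,\nu}\sum_{m=1}^2\big((s_m)_{i_\mu,j_\nu}-(\overline s_m)_{i,j}\big)[\nabla_{\boldsymbol\xi}\cdot\boldsymbol{\mathcal R}_m]_{i_\mu,j_\nu}$, (T2)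 $\displaystyle \frac{d\overline J_{i,j}}{dt}=-\tfrac1{\Delta\xi_1}\sum_\mu\omega_\mu\Big(\big(J\tfrac{\partial\xi_1}{\partial t}\big)^\mu_{i+\frac12,j}-\big(J\tfrac{\partial\xi_1}{\partial t}\big)^\mu_{i-\frac12,j}\Big)-\tfrac1{\Delta\xi_2}\sum_\mu\omega_\mu\Big(\big(J\tfrac{\partial\xi_2}{\partial t}\big)^\mu_{i,j+\frac12}-\big(J\tfrac{\partial\xi_2}{\partial t}\big)^\mu_{i,j-\frac12}\Big)$, (T3) for $k=1,2$: $\displaystyle \tfrac1{\Delta\xi_1}\sum_\mu\omega_\mu\Big(\big(J\tfrac{\partial\xi_1}{\partial x_k}\big)^\mu_{i+\frac12,j}-\big(J\tfrac{\partial\xi_1}{\partial x_k}\big)^\mu_{i-\frac12,j}\Big)+\tfrac1{\Delta\xi_2}\sum_\mu\omega_\mu\Big(\big(J\tfrac{\partial\xi_2}{\partial x_k}\big)^\mu_{i,j+\frac12}-\big(J\tfrac{\partial\xi_2}{\partial x_k}\big)^\mu_{i,j-\frac12}\Big)=0$, (T4) $\displaystyle \frac{d\,\overline{J\boldsymbol w}_{i,j}}{dt}=-\tfrac1{\Delta\xi_1}(\widetilde{\boldsymbol w}_{i+\frac12,j}-\widetilde{\boldsymbol w}_{i-\frac12,j})-\tfrac1{\Delta\xi_2}(\widetilde{\boldsymbol w}_{i,j+\frac12}-\widetilde{\boldsymbol w}_{i,j-\frac12})$, (T5) the same as (T4) with $\boldsymbol w$ replaced by $\boldsymbol q$ throughout.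 Here $$\widetilde{\boldsymbol w}_{i\pm\frac12,j}=\sum_\mu\omega_\mu\Big[\big(J\tfrac{\partial\xi_1}{\partial t}\big)^\mu_{i\pm\frac12,j}\{\!\{\boldsymbol w\}\!\}^\mu_{i\pm\frac12,j}-\tfrac{\alpha_1}2[\![\boldsymbol w]\!]^\mu_{i\pm\frac12,j}\Big],\qquad \widetilde{\boldsymbol w}_{i,j\pm\frac12}=\sum_\mu\omega_\mu\Big[\big(J\tfrac{\partial\xi_2}{\partial t}\big)^\mu_{i,j\pm\frac12}\{\!\{\boldsymbol w\}\!\}^\mu_{i,j\pm\frac12}-\tfrac{\alpha_2}2[\![\boldsymbol w]\!]^\mu_{i,j\pm\frac12}\Big],$$ (and analogously $\widetilde{\boldsymbol q}$); $$(\widetilde{\boldsymbol{\mathcal F}}_1)_{i\pm\frac12,j}=\sum_\mu\omega_\mu\Big[\big(J\tfrac{\partial\xi_1}{\partial t}\big)^\mu_{i\pm\frac12,j}\{\!\{\boldsymbol U\}\!\}^\mu_{i\pm\frac12,j}-\tfrac{\alpha_1}2[\![\boldsymbol U]\!]^\mu_{i\pm\frac12,j}+(L_1)^\mu_{i\pm\frac12,j}(\widetilde{\boldsymbol F}_{n_1})^\mu_{i\pm\frac12,j}\Big],$$ $$(\widetilde{\boldsymbol{\mathcal F}}_2)_{i,j\pm\frac12}=\sum_\mu\omega_\mu\Big[\big(J\tfrac{\partial\xi_2}{\partial t}\big)^\mu_{i,j\pm\frac12}\{\!\{\boldsymbol U\}\!\}^\mu_{i,j\pm\frac12}-\tfrac{\alpha_2}2[\![\boldsymbol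 U]\!]^\mu_{i,j\pm\frac12}+(L_2)^\mu_{i,j\pm\frac12}(\widetilde{\boldsymbol F}_{n_2})^\mu_{i,j\pm\frac12}\Big];$$ $[\nabla_{\boldsymbol\xi}\cdot\boldsymbol{\mathcal R}_m]_{i_\mu,j_\nu}$ is a (finite) numerical approximation of $\sum_\ell\partial_{\xi_\ell}\big(\sum_kJ\frac{\partial\xi_\ell}{\partial x_k}\boldsymbol r_{mk}\big)$. *Hydrostatic-reconstruction fluxes.* Let $e$ denote an interface node, and $\ell=1$ if it lies on an interface $i\pm\frac12,j$, $\ell=2$ if on an interface $i,j\pm\frac12$. Set $h^{\pm,*}_e=\max(0,h^\pm_e+b^\pm_e-\max(b^+_e,b^-_e))$ and $\boldsymbol U^{\pm,*}_e=(h^{\pm,*}_e,\ h^{\pm,*}_e(v_1)^\pm_e,\ h^{\pm,*}_e(v_2)^\pm_e)^\top$. In the equation for cell $(i,j)$, let $\sigma=-$ if $e$ is on the interface $i+\frac12,j$ or $i,j+\frac12$, and $\sigma=+$ if $e$ is on $i-\frac12,j$ or $i,j-\frac12$ (so $\sigma$ selects the trace from inside cell $(i,j)$). Then $$(\widetilde{\boldsymbol F}_{n_\ell})_e=\big\langle(\boldsymbol n_\ell)_e,\ \big((\widetilde{\boldsymbol F}_1)_e,(\widetilde{\boldsymbol F}_2)_e\big)\big\rangle-\tfrac\beta2\big(\boldsymbol U^{+,*}_e-\boldsymbol U^{-,*}_e\big),$$ $$(\widetilde{\boldsymbol F}_1)_e=\tfrac12\big(\boldsymbol F_1(\boldsymbol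 U^{-,*}_e)+\boldsymbol F_1(\boldsymbol U^{+,*}_e)\big)+\big(0,\ \tfrac g2(h^\sigma_e)^2-\tfrac g2(h^{\sigma,*}_e)^2,\ 0\big)^\top,$$ $$(\widetilde{\boldsymbol F}_2)_e=\tfrac12\big(\boldsymbol F_2(\boldsymbol U^{-,*}_e)+\boldsymbol F_2(\boldsymbol U^{+,*}_e)\big)+\big(0,\ 0,\ \tfrac g2(h^\sigma_e)^2-\tfrac g2(h^{\sigma,*}_e)^2\big)^\top.$$ The source fluxes are $(\widetilde{\boldsymbol{\mathcal R}}_{m1})_{i\pm\frac12,j}=\sum_\mu\omega_\mu(L_1)^\mu_{i\pm\frac12,j}\langle(\boldsymbol n_1)^\mu_{i\pm\frac12,j},(\boldsymbol r_m)^{\mp,\mu}_{i\pm\frac12,j}\rangle$ and $(\widetilde{\boldsymbol{\mathcal R}}_{m2})_{i,j\pm\frac12}=\sum_\mu\omega_\mu(L_2)^\mu_{i,j\pm\frac12}\langle(\boldsymbol n_2)^\mu_{i,j\pm\frac12},(\boldsymbol r_m)^{\mp,\mu}_{i,j\pm\frac12}\rangle$, where $(\boldsymbol r_m)^{\mp}$ is $\boldsymbol r_m$ evaluated with the trace $b^{\mp}$.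
   Formalization: The boundary conditions are assumed compatible with the steady state at every time level and stage: if all interior cells satisfy U+w=Cq (resp. q=(1,0,0)), so do the ghost cells; without this, prescribed ghost values can break the claim. *)

theory Defs
  imports "HOL-Analysis.Analysis"
begin

section \<open>Mesh and data\<close>

datatype axis = Xi1 | Xi2

text \<open>The two one-sided traces at an interface: \<open>Minus\<close> comes from the cell with the smaller index.\<close>
datatype side = Minus | Plus

text \<open>
  \<open>ncells p ax\<close> interior cells and \<open>nghost p\<close> layers of ghost cells per side. Interior cells are
  numbered from 1, so ghost cells may have nonpositive indices.
\<close>
record params =
  ncells :: "axis \<Rightarrow> nat"
  nghost :: nat
  dxi :: "axis \<Rightarrow> real"
  grav :: real

definition valid_params :: "params \<Rightarrow> bool" where
  "valid_params p \<longleftrightarrow>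
     (\<forall>ax. ncells p ax \<ge> 1 \<and> dxi p ax > 0) \<and> nghost p \<ge> 1 \<and> grav p > 0"

definition interior_cells :: "params \<Rightarrow> (int \<times> int) set" where
  "interior_cells p = {1..int (ncells p Xi1)} \<times> {1..int (ncells p Xi2)}"

definition cells :: "params \<Rightarrow> (int \<times> int) set" where
  "cells p = {1 - int (nghost p)..int (ncells p Xi1) + int (nghost p)} \<times>
             {1 - int (nghost p)..int (ncells p Xi2) + int (nghost p)}"

definition ghost_cells :: "params \<Rightarrow> (int \<times> int) set" where
  "ghost_cells p = cells p - interior_cells p"

text \<open>Gauss--Lobatto nodes are indexed by \<open>1, \<dots>, Q\<close> with \<open>Q = 4\<close>; weights are normalized to sum 1.\<close>
definition nodes :: "nat set" where
  "nodes = {1..4}"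

definition weight :: "nat \<Rightarrow> real" where
  "weight \<mu> = (if \<mu> = 1 \<or> \<mu> = 4 then 1 / 12 else 5 / 12)"

text \<open>
  The interface node \<open>(i, j, \<mu>)\<close> of axis \<open>Xi1\<close> lies on the interface \<open>(i + 1/2, j)\<close>, that of axis
  \<open>Xi2\<close> on \<open>(i, j + 1/2)\<close>. The set contains all interface nodes of the interior cells.
\<close>
definition face_nodes :: "params \<Rightarrow> axis \<Rightarrow> (int \<times> int \<times> nat) set" where
  "face_nodes p ax = (case ax of
      Xi1 \<Rightarrow> {0..int (ncells p Xi1)} \<times> {1..int (ncells p Xi2)} \<times> nodes
    | Xi2 \<Rightarrow> {1..int (ncells p Xi1)} \<times> {0..int (ncells p Xi2)} \<times> nodes)"

text \<open>
  The cell averages of \<open>J U\<close>, \<open>J\<close>, \<open>J w\<close>, \<open>J q\<close> in one cell. They are kept in one product vector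
  space because the time integrator acts on all evolution equations simultaneously.
\<close>
type_synonym cell_avg = "(real^3) \<times> real \<times> (real^3) \<times> (real^3)"

type_synonym state = "int \<Rightarrow> int \<Rightarrow> cell_avg"

definition JU_bar :: "cell_avg \<Rightarrow> real^3" where "JU_bar a = fst a"
definition J_bar :: "cell_avg \<Rightarrow> real" where "J_bar a = fst (snd a)"
definition Jw_bar :: "cell_avg \<Rightarrow> real^3" where "Jw_bar a = fst (snd (snd a))"
definition Jq_bar :: "cell_avg \<Rightarrow> real^3" where "Jq_bar a = snd (snd (snd a))"

definition U_bar :: "cell_avg \<Rightarrow> real^3" where "U_bar a = (1 / J_bar a) *\<^sub>R JU_bar a"
definition w_bar :: "cell_avg \<Rightarrow> real^3" where "w_bar a = (1 / J_bar a) *\<^sub>R Jw_bar a"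
definition q_bar :: "cell_avg \<Rightarrow> real^3" where "q_bar a = (1 / J_bar a) *\<^sub>R Jq_bar a"

type_synonym 'a nodal = "int \<Rightarrow> int \<Rightarrow> nat \<Rightarrow> nat \<Rightarrow> 'a"

text \<open>
  Everything that is available in one Runge--Kutta stage besides the cell averages: the
  reconstructed and limited node values \<open>u i j \<mu> \<nu>\<close> of \<open>J\<close>, \<open>U\<close>, \<open>b\<close>, \<open>q\<close>; the single-valued metrics
  \<open>metric ax i j \<mu> $ k = (J \<partial>\<xi>_ax/\<partial>x_k)\<close> and mesh velocities at the interface nodes; and the node values
  \<open>div_r m\<close> of the approximation of \<open>\<Sum>\<^sub>l \<partial>/\<partial>\<xi>\<^sub>l (\<Sum>\<^sub>k J \<partial>\<xi>\<^sub>l/\<partial>x\<^sub>k r\<^sub>m\<^sub>k)\<close>.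
\<close>
record stage_data =
  J_nd :: "real nodal"
  U_nd :: "(real^3) nodal"
  b_nd :: "real nodal"
  q_nd :: "(real^3) nodal"
  metric :: "axis \<Rightarrow> int \<Rightarrow> int \<Rightarrow> nat \<Rightarrow> real^2"
  mesh_vel :: "axis \<Rightarrow> int \<Rightarrow> int \<Rightarrow> nat \<Rightarrow> real^2"
  div_r :: "nat \<Rightarrow> (real^3) nodal"

definition h_nd :: "stage_data \<Rightarrow> real nodal" where
  "h_nd D i j \<mu> \<nu> = U_nd D i j \<mu> \<nu> $ 1"

definition w_nd :: "stage_data \<Rightarrow> (real^3) nodal" where
  "w_nd D i j \<mu> \<nu> = vector [b_nd D i j \<mu> \<nu>, 0, 0]"

definition e1 :: "real^3" where
  "e1 = vector [1, 0, 0]"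

section \<open>Traces, jumps and averages at interface nodes\<close>

fun face_trace :: "'a nodal \<Rightarrow> side \<Rightarrow> axis \<Rightarrow> int \<Rightarrow> int \<Rightarrow> nat \<Rightarrow> 'a" where
  "face_trace u Minus Xi1 i j \<mu> = u i j 4 \<mu>"
| "face_trace u Plus  Xi1 i j \<mu> = u (i + 1) j 1 \<mu>"
| "face_trace u Minus Xi2 i j \<mu> = u i j \<mu> 4"
| "face_trace u Plus  Xi2 i j \<mu> = u i (j + 1) \<mu> 1"

definition jump :: "'a::real_vector nodal \<Rightarrow> axis \<Rightarrow> int \<Rightarrow> int \<Rightarrow> nat \<Rightarrow> 'a" where
  "jump u ax i j \<mu> = face_trace u Plus ax i j \<mu> - face_trace u Minus ax i j \<mu>"

definition avg :: "'a::real_vector nodal \<Rightarrow> axis \<Rightarrow> int \<Rightarrow> int \<Rightarrow> nat \<Rightarrow> 'a" where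
  "avg u ax i j \<mu> = (1 / 2) *\<^sub>R (face_trace u Plus ax i j \<mu> + face_trace u Minus ax i j \<mu>)"

text \<open>
  \<open>f \<sigma> i j\<close> is a quantity on the interface \<open>(i + 1/2, j)\<close> resp. \<open>(i, j + 1/2)\<close> that may depend on the
  side \<open>\<sigma>\<close> from which it is seen. For cell \<open>(i, j)\<close>, the inside of its upper interface is \<open>Minus\<close>
  and the inside of its lower interface is \<open>Plus\<close>.
\<close>
fun face_diff :: "axis \<Rightarrow> (side \<Rightarrow> int \<Rightarrow> int \<Rightarrow> 'a::real_vector) \<Rightarrow> int \<Rightarrow> int \<Rightarrow> 'a" where
  "face_diff Xi1 f i j = f Minus i j - f Plus (i - 1) j"
| "face_diff Xi2 f i j = f Minus i j - f Plus i (j - 1)"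

section \<open>Metrics\<close>

definition Lmet :: "stage_data \<Rightarrow> axis \<Rightarrow> int \<Rightarrow> int \<Rightarrow> nat \<Rightarrow> real" where
  "Lmet D ax i j \<mu> = sqrt (\<Sum>k\<in>UNIV. (metric D ax i j \<mu> $ k)\<^sup>2)"

definition normal :: "stage_data \<Rightarrow> axis \<Rightarrow> int \<Rightarrow> int \<Rightarrow> nat \<Rightarrow> real^2" where
  "normal D ax i j \<mu> = (1 / Lmet D ax i j \<mu>) *\<^sub>R metric D ax i j \<mu>"

definition tmet_hat :: "stage_data \<Rightarrow> axis \<Rightarrow> int \<Rightarrow> int \<Rightarrow> nat \<Rightarrow> real" where
  "tmet_hat D ax i j \<mu> = - (\<Sum>k\<in>UNIV. mesh_vel D ax i j \<mu> $ k * metric D ax i j \<mu> $ k)"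

text \<open>\<open>J\<close> is two-valued at an interface node, and the maximum runs over both traces.\<close>
definition beta_J :: "params \<Rightarrow> stage_data \<Rightarrow> axis \<Rightarrow> real" where
  "beta_J p D ax =
     Max ((\<lambda>(\<sigma>, i, j, \<mu>). \<bar>tmet_hat D ax i j \<mu> / face_trace (J_nd D) \<sigma> ax i j \<mu>\<bar>) `
          ({Minus, Plus} \<times> face_nodes p ax))"

definition tmet :: "params \<Rightarrow> stage_data \<Rightarrow> axis \<Rightarrow> int \<Rightarrow> int \<Rightarrow> nat \<Rightarrow> real" where
  "tmet p D ax i j \<mu> = tmet_hat D ax i j \<mu> - beta_J p D ax / 2 * jump (J_nd D) ax i j \<mu>"

definition alpha :: "params \<Rightarrow> stage_data \<Rightarrow> axis \<Rightarrow> real" where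
  "alpha p D ax = Max ((\<lambda>(i, j, \<mu>). \<bar>tmet p D ax i j \<mu>\<bar>) ` face_nodes p ax)"

section \<open>Shallow water fluxes and source decomposition\<close>

text \<open>Velocity component recovered from depth \<open>h\<close> and momentum \<open>m\<close>, desingularized near dry states.\<close>
definition vel :: "params \<Rightarrow> real \<Rightarrow> real \<Rightarrow> real" where
  "vel p h m =
     (if h > 1 / 10 ^ 4 then m / h
      else sqrt 2 * h * m / sqrt (h ^ 4 + max (h ^ 4) ((dxi p Xi1 * dxi p Xi2)\<^sup>2)))"

definition beta :: "params \<Rightarrow> state \<Rightarrow> real" where
  "beta p S =
     Max ((\<lambda>(i, j). let U = U_bar (S i j) in
            sqrt ((vel p (U $ 1) (U $ 2))\<^sup>2 + (vel p (U $ 1) (U $ 3))\<^sup>2) + sqrt (grav p * U $ 1))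
          ` cells p)"

text \<open>
  Conserved variables and physical fluxes as functions of depth and velocity; this avoids dividing
  by the depth when \<open>F\<^sub>k\<close> is evaluated at a (possibly dry) hydrostatically reconstructed state.
\<close>
definition cons_vars :: "real \<Rightarrow> real \<Rightarrow> real \<Rightarrow> real^3" where
  "cons_vars h v1 v2 = vector [h, h * v1, h * v2]"

definition F1 :: "params \<Rightarrow> real \<Rightarrow> real \<Rightarrow> real \<Rightarrow> real^3" where
  "F1 p h v1 v2 = vector [h * v1, h * v1\<^sup>2 + grav p / 2 * h\<^sup>2, h * v1 * v2]"

definition F2 :: "params \<Rightarrow> real \<Rightarrow> real \<Rightarrow> real \<Rightarrow> real^3" where
  "F2 p h v1 v2 = vector [h * v2, h * v1 * v2, h * v2\<^sup>2 + grav p / 2 * h\<^sup>2]"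

definition pair_dot :: "real^2 \<Rightarrow> (real^3) \<times> (real^3) \<Rightarrow> real^3" where
  "pair_dot n A = (n $ 1) *\<^sub>R fst A + (n $ 2) *\<^sub>R snd A"

text \<open>The pairs \<open>r\<^sub>1 = ((0,b,0), (0,0,b))\<close> and \<open>r\<^sub>2 = ((0,b\<^sup>2,0), (0,0,b\<^sup>2))\<close>, for \<open>m = 1, 2\<close>.\<close>
definition r_vec :: "nat \<Rightarrow> real \<Rightarrow> (real^3) \<times> (real^3)" where
  "r_vec m b = (vector [0, b ^ m, 0], vector [0, 0, b ^ m])"

definition s_coef :: "params \<Rightarrow> nat \<Rightarrow> real \<Rightarrow> real \<Rightarrow> real" where
  "s_coef p m h b = (if m = 1 then - grav p * (h + b) else grav p / 2)"

definition s_bar :: "params \<Rightarrow> state \<Rightarrow> nat \<Rightarrow> int \<Rightarrow> int \<Rightarrow> real" where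
  "s_bar p S m i j = s_coef p m (U_bar (S i j) $ 1) (w_bar (S i j) $ 1)"

definition s_nd :: "params \<Rightarrow> stage_data \<Rightarrow> nat \<Rightarrow> real nodal" where
  "s_nd p D m i j \<mu> \<nu> = s_coef p m (h_nd D i j \<mu> \<nu>) (b_nd D i j \<mu> \<nu>)"

section \<open>Numerical fluxes\<close>

definition v_nd :: "params \<Rightarrow> stage_data \<Rightarrow> 3 \<Rightarrow> real nodal" where
  "v_nd p D c i j \<mu> \<nu> = vel p (h_nd D i j \<mu> \<nu>) (U_nd D i j \<mu> \<nu> $ c)"

definition h_star :: "stage_data \<Rightarrow> side \<Rightarrow> axis \<Rightarrow> int \<Rightarrow> int \<Rightarrow> nat \<Rightarrow> real" where
  "h_star D \<sigma> ax i j \<mu> =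
     max 0 (face_trace (h_nd D) \<sigma> ax i j \<mu> + face_trace (b_nd D) \<sigma> ax i j \<mu>
            - max (face_trace (b_nd D) Plus ax i j \<mu>) (face_trace (b_nd D) Minus ax i j \<mu>))"

text \<open>\<open>at_star p D f \<sigma> \<dots>\<close> is \<open>f\<close> at depth \<open>h\<^sup>*\<close> and the (unmodified) traces of both velocities;
  momentum components are numbers 2 and 3 of \<open>U\<close>.\<close>
definition at_star ::
  "params \<Rightarrow> stage_data \<Rightarrow> (real \<Rightarrow> real \<Rightarrow> real \<Rightarrow> real^3) \<Rightarrow> side \<Rightarrow> axis \<Rightarrow> int \<Rightarrow> int \<Rightarrow> nat \<Rightarrow> real^3"
  where
  "at_star p D f \<sigma> ax i j \<mu> =
     f (h_star D \<sigma> ax i j \<mu>) (face_trace (v_nd p D 2) \<sigma> ax i j \<mu>) (face_trace (v_nd p D 3) \<sigma> ax i j \<mu>)"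

definition hr_correction ::
  "params \<Rightarrow> stage_data \<Rightarrow> side \<Rightarrow> axis \<Rightarrow> int \<Rightarrow> int \<Rightarrow> nat \<Rightarrow> real" where
  "hr_correction p D \<sigma> ax i j \<mu> =
     grav p / 2 * (face_trace (h_nd D) \<sigma> ax i j \<mu>)\<^sup>2 - grav p / 2 * (h_star D \<sigma> ax i j \<mu>)\<^sup>2"

definition F1_tilde :: "params \<Rightarrow> stage_data \<Rightarrow> side \<Rightarrow> axis \<Rightarrow> int \<Rightarrow> int \<Rightarrow> nat \<Rightarrow> real^3" where
  "F1_tilde p D \<sigma> ax i j \<mu> =
     (1 / 2) *\<^sub>R (at_star p D (F1 p) Minus ax i j \<mu> + at_star p D (F1 p) Plus ax i j \<mu>)
     + vector [0, hr_correction p D \<sigma> ax i j \<mu>, 0]"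

definition F2_tilde :: "params \<Rightarrow> stage_data \<Rightarrow> side \<Rightarrow> axis \<Rightarrow> int \<Rightarrow> int \<Rightarrow> nat \<Rightarrow> real^3" where
  "F2_tilde p D \<sigma> ax i j \<mu> =
     (1 / 2) *\<^sub>R (at_star p D (F2 p) Minus ax i j \<mu> + at_star p D (F2 p) Plus ax i j \<mu>)
     + vector [0, 0, hr_correction p D \<sigma> ax i j \<mu>]"

definition Fn_tilde ::
  "params \<Rightarrow> stage_data \<Rightarrow> state \<Rightarrow> side \<Rightarrow> axis \<Rightarrow> int \<Rightarrow> int \<Rightarrow> nat \<Rightarrow> real^3" where
  "Fn_tilde p D S \<sigma> ax i j \<mu> =
     pair_dot (normal D ax i j \<mu>) (F1_tilde p D \<sigma> ax i j \<mu>, F2_tilde p D \<sigma> ax i j \<mu>)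
     - (beta p S / 2) *\<^sub>R
         (at_star p D cons_vars Plus ax i j \<mu> - at_star p D cons_vars Minus ax i j \<mu>)"

text \<open>Mesh-motion (Lax--Friedrichs) part of the flux at one interface node; common to \<open>U\<close>, \<open>w\<close>, \<open>q\<close>.\<close>
definition motion_flux ::
  "params \<Rightarrow> stage_data \<Rightarrow> (real^3) nodal \<Rightarrow> axis \<Rightarrow> int \<Rightarrow> int \<Rightarrow> nat \<Rightarrow> real^3" where
  "motion_flux p D u ax i j \<mu> =
     tmet p D ax i j \<mu> *\<^sub>R avg u ax i j \<mu> - (alpha p D ax / 2) *\<^sub>R jump u ax i j \<mu>"

definition flux_transport ::
  "params \<Rightarrow> stage_data \<Rightarrow> (real^3) nodal \<Rightarrow> axis \<Rightarrow> int \<Rightarrow> int \<Rightarrow> real^3" where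
  "flux_transport p D u ax i j = (\<Sum>\<mu>\<in>nodes. weight \<mu> *\<^sub>R motion_flux p D u ax i j \<mu>)"

definition flux_U ::
  "params \<Rightarrow> stage_data \<Rightarrow> state \<Rightarrow> axis \<Rightarrow> side \<Rightarrow> int \<Rightarrow> int \<Rightarrow> real^3" where
  "flux_U p D S ax \<sigma> i j =
     (\<Sum>\<mu>\<in>nodes. weight \<mu> *\<^sub>R
        (motion_flux p D (U_nd D) ax i j \<mu> + Lmet D ax i j \<mu> *\<^sub>R Fn_tilde p D S \<sigma> ax i j \<mu>))"

definition flux_R :: "stage_data \<Rightarrow> nat \<Rightarrow> axis \<Rightarrow> side \<Rightarrow> int \<Rightarrow> int \<Rightarrow> real^3" where
  "flux_R D m ax \<sigma> i j =
     (\<Sum>\<mu>\<in>nodes. (weight \<mu> * Lmet D ax i j \<mu>) *\<^sub>R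
        pair_dot (normal D ax i j \<mu>) (r_vec m (face_trace (b_nd D) \<sigma> ax i j \<mu>)))"

section \<open>The semi-discrete scheme\<close>

definition rhs_JU :: "params \<Rightarrow> stage_data \<Rightarrow> state \<Rightarrow> int \<Rightarrow> int \<Rightarrow> real^3" where
  "rhs_JU p D S i j =
     (\<Sum>ax\<in>{Xi1, Xi2}.
        - ((1 / dxi p ax) *\<^sub>R face_diff ax (flux_U p D S ax) i j)
        + (1 / dxi p ax) *\<^sub>R (\<Sum>m\<in>{1, 2}. s_bar p S m i j *\<^sub>R face_diff ax (flux_R D m ax) i j))
     + (\<Sum>\<mu>\<in>nodes. \<Sum>\<nu>\<in>nodes. (weight \<mu> * weight \<nu>) *\<^sub>R
          (\<Sum>m\<in>{1, 2}. (s_nd p D m i j \<mu> \<nu> - s_bar p S m i j) *\<^sub>R div_r D m i j \<mu> \<nu>))"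

definition rhs_J :: "params \<Rightarrow> stage_data \<Rightarrow> int \<Rightarrow> int \<Rightarrow> real" where
  "rhs_J p D i j =
     (\<Sum>ax\<in>{Xi1, Xi2}.
        - (1 / dxi p ax * face_diff ax (\<lambda>_ i j. \<Sum>\<mu>\<in>nodes. weight \<mu> * tmet p D ax i j \<mu>) i j))"

definition rhs_transport ::
  "params \<Rightarrow> stage_data \<Rightarrow> (real^3) nodal \<Rightarrow> int \<Rightarrow> int \<Rightarrow> real^3" where
  "rhs_transport p D u i j =
     (\<Sum>ax\<in>{Xi1, Xi2}. - ((1 / dxi p ax) *\<^sub>R face_diff ax (\<lambda>_. flux_transport p D u ax) i j))"

definition rhs :: "params \<Rightarrow> stage_data \<Rightarrow> state \<Rightarrow> int \<Rightarrow> int \<Rightarrow> cell_avg" where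
  "rhs p D S i j =
     (rhs_JU p D S i j, rhs_J p D i j,
      rhs_transport p D (w_nd D) i j, rhs_transport p D (q_nd D) i j)"

definition surface_conservation_laws :: "params \<Rightarrow> stage_data \<Rightarrow> bool" where
  "surface_conservation_laws p D \<longleftrightarrow>
     (\<forall>k. \<forall>(i, j)\<in>interior_cells p.
        (\<Sum>ax\<in>{Xi1, Xi2}. 1 / dxi p ax *
           face_diff ax (\<lambda>_ i j. \<Sum>\<mu>\<in>nodes. weight \<mu> * metric D ax i j \<mu> $ k) i j) = 0)"

section \<open>Reconstruction and boundary conditions\<close>

definition conservative_reconstruction :: "params \<Rightarrow> stage_data \<Rightarrow> state \<Rightarrow> bool" where
  "conservative_reconstruction p D S \<longleftrightarrow>
     (\<forall>(i, j)\<in>cells p.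
        (\<Sum>\<mu>\<in>nodes. \<Sum>\<nu>\<in>nodes. weight \<mu> * weight \<nu> * J_nd D i j \<mu> \<nu>) = J_bar (S i j) \<and>
        (\<Sum>\<mu>\<in>nodes. \<Sum>\<nu>\<in>nodes. (weight \<mu> * weight \<nu> * J_nd D i j \<mu> \<nu>) *\<^sub>R U_nd D i j \<mu> \<nu>)
          = JU_bar (S i j))"

definition positive_reconstruction :: "params \<Rightarrow> stage_data \<Rightarrow> bool" where
  "positive_reconstruction p D \<longleftrightarrow>
     (\<forall>(i, j)\<in>cells p. \<forall>\<mu>\<in>nodes. \<forall>\<nu>\<in>nodes. J_nd D i j \<mu> \<nu> > 0 \<and> h_nd D i j \<mu> \<nu> \<ge> 0)"

definition steady_preserving_reconstruction :: "params \<Rightarrow> stage_data \<Rightarrow> state \<Rightarrow> bool" where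
  "steady_preserving_reconstruction p D S \<longleftrightarrow>
     (\<forall>C. (\<forall>(i, j)\<in>cells p. U_bar (S i j) + w_bar (S i j) = C *\<^sub>R q_bar (S i j)) \<longrightarrow>
          (\<forall>(i, j)\<in>cells p. \<forall>\<mu>\<in>nodes. \<forall>\<nu>\<in>nodes.
             U_nd D i j \<mu> \<nu> + w_nd D i j \<mu> \<nu> = C *\<^sub>R q_nd D i j \<mu> \<nu>))"

text \<open>
  Constants are reproduced. That the node values of \<open>q\<close> equal \<open>(1,0,0)\<close> at all times is a
  consequence of this, the initialization of \<open>q\<close> and the evolution equations.
\<close>
definition constant_preserving_reconstruction :: "params \<Rightarrow> stage_data \<Rightarrow> state \<Rightarrow> bool" where
  "constant_preserving_reconstruction p D S \<longleftrightarrow>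
     (\<forall>c. (\<forall>(i, j)\<in>cells p. q_bar (S i j) = c) \<longrightarrow>
          (\<forall>(i, j)\<in>cells p. \<forall>\<mu>\<in>nodes. \<forall>\<nu>\<in>nodes. q_nd D i j \<mu> \<nu> = c))"

definition admissible_stage :: "params \<Rightarrow> stage_data \<Rightarrow> state \<Rightarrow> bool" where
  "admissible_stage p D S \<longleftrightarrow>
     surface_conservation_laws p D \<and>
     conservative_reconstruction p D S \<and>
     positive_reconstruction p D \<and>
     steady_preserving_reconstruction p D S \<and>
     constant_preserving_reconstruction p D S"

definition positive_J :: "params \<Rightarrow> state \<Rightarrow> bool" where
  "positive_J p S \<longleftrightarrow> (\<forall>(i, j)\<in>cells p. J_bar (S i j) > 0)"

text \<open>
  Ghost averages are not evolved but supplied by boundary conditions. Which ones is left open; they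
  only have to be compatible with the steady state (if the interior cells are at rest at level \<open>C\<close>,
  then so are the ghost cells) and with the constant auxiliary variable \<open>q\<close>. Without such
  compatibility (e.g. with a prescribed inflow) the ghost cells would destroy the steady state.
\<close>
definition compatible_ghost_values :: "params \<Rightarrow> state \<Rightarrow> bool" where
  "compatible_ghost_values p S \<longleftrightarrow>
     (\<forall>C. (\<forall>(i, j)\<in>interior_cells p. U_bar (S i j) + w_bar (S i j) = C *\<^sub>R q_bar (S i j)) \<longrightarrow>
          (\<forall>(i, j)\<in>ghost_cells p. U_bar (S i j) + w_bar (S i j) = C *\<^sub>R q_bar (S i j))) \<and>
     ((\<forall>(i, j)\<in>interior_cells p. q_bar (S i j) = e1) \<longrightarrow>
          (\<forall>(i, j)\<in>ghost_cells p. q_bar (S i j) = e1))"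

section \<open>Time discretization\<close>

text \<open>
  \<open>SSP_RK s a c\<close> is the \<open>s\<close>-stage explicit SSP method in Shu--Osher form
  \<open>u\<^sup>(\<^sup>m\<^sup>) = \<Sum>k<m. a\<^sub>m\<^sub>k u\<^sup>(\<^sup>k\<^sup>) + \<Delta>t c\<^sub>m\<^sub>k L(u\<^sup>(\<^sup>k\<^sup>))\<close>, \<open>m = 1, \<dots>, s\<close>.
\<close>
datatype time_integrator = Forward_Euler | SSP_RK nat "nat \<Rightarrow> nat \<Rightarrow> real" "nat \<Rightarrow> nat \<Rightarrow> real"

fun valid_integrator :: "time_integrator \<Rightarrow> bool" where
  "valid_integrator Forward_Euler \<longleftrightarrow> True"
| "valid_integrator (SSP_RK s a c) \<longleftrightarrow>
     s \<ge> 1 \<and>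
     (\<forall>m\<in>{1..s}. (\<Sum>k<m. a m k) = 1 \<and>
        (\<forall>k<m. a m k \<ge> 0 \<and> c m k \<ge> 0 \<and> (a m k = 0 \<longrightarrow> c m k = 0)))"

fun num_stages :: "time_integrator \<Rightarrow> nat" where
  "num_stages Forward_Euler = 1"
| "num_stages (SSP_RK s a c) = s"

text \<open>\<open>Y 0, Y 1, \<dots>\<close> are the stage values of one time step and \<open>D k\<close> the data belonging to \<open>Y k\<close>.\<close>
fun time_step ::
  "params \<Rightarrow> time_integrator \<Rightarrow> real \<Rightarrow> (nat \<Rightarrow> stage_data) \<Rightarrow> (nat \<Rightarrow> state) \<Rightarrow> bool" where
  "time_step p Forward_Euler dt D Y \<longleftrightarrow>
     (\<forall>(i, j)\<in>interior_cells p. Y 1 i j = Y 0 i j + dt *\<^sub>R rhs p (D 0) (Y 0) i j)"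
| "time_step p (SSP_RK s a c) dt D Y \<longleftrightarrow>
     (\<forall>m\<in>{1..s}. \<forall>(i, j)\<in>interior_cells p.
        Y m i j = (\<Sum>k<m. a m k *\<^sub>R Y k i j + (dt * c m k) *\<^sub>R rhs p (D k) (Y k) i j))"

text \<open>
  \<open>S 0, \<dots>, S (Suc n)\<close> are the states at the time levels and \<open>Y m k\<close> is the \<open>k\<close>-th stage of the
  step from level \<open>m\<close> to level \<open>m + 1\<close>, with data \<open>D m k\<close>. Reconstruction data are needed only for
  the stages at which the right-hand side is evaluated.
\<close>
definition numerical_solution ::
  "params \<Rightarrow> time_integrator \<Rightarrow> (nat \<Rightarrow> real) \<Rightarrow> (nat \<Rightarrow> nat \<Rightarrow> stage_data) \<Rightarrow>
   (nat \<Rightarrow> nat \<Rightarrow> state) \<Rightarrow> (nat \<Rightarrow> state) \<Rightarrow> nat \<Rightarrow> bool" where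
  "numerical_solution p T dt D Y S n \<longleftrightarrow>
     (\<forall>(i, j)\<in>cells p. q_bar (S 0 i j) = e1) \<and>
     (\<forall>m\<le>n. dt m > 0 \<and>
        Y m 0 = S m \<and> Y m (num_stages T) = S (Suc m) \<and>
        time_step p T (dt m) (D m) (Y m) \<and>
        (\<forall>k\<le>num_stages T. positive_J p (Y m k) \<and> compatible_ghost_values p (Y m k)) \<and>
        (\<forall>k<num_stages T. admissible_stage p (D m k) (Y m k)))"

end

(*
  At a lake at rest of level C the velocities vanish and h + b = C at every node, so both
  hydrostatically reconstructed depths at an interface node agree. What remains of the physical flux
  is the pressure g/2 (C - b)^2 times the metric, and the source fluxes contribute
  (-g C b + g/2 b^2) times the metric. The difference g/2 C^2 does not depend on the node, hence the
  surface conservation laws annihilate it, and J U evolves by the mesh-motion flux alone, like J w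
  and J q. Since that flux is linear, it vanishes for U + w - C q = 0. A linear quantity of the cell
  averages that is annihilated by the right-hand side is preserved by every stage; this is applied
  first to Jq - J (1,0,0) and then to JU + Jw - C Jq.
*)
theory Submission
  imports Defs
begin

section \<open>Traces and differences at the interfaces of interior cells\<close>

definition face_cells :: "params \<Rightarrow> axis \<Rightarrow> (int \<times> int) set" where
  "face_cells p ax = (case ax of
      Xi1 \<Rightarrow> {0..int (ncells p Xi1)} \<times> {1..int (ncells p Xi2)}
    | Xi2 \<Rightarrow> {1..int (ncells p Xi1)} \<times> {0..int (ncells p Xi2)})"

lemma interior_subset_cells: "interior_cells p \<subseteq> cells p"
  by (auto simp: interior_cells_def cells_def)

text \<open>Applied to a boolean nodal \<open>P\<close>, \<open>face_trace\<close> selects the instance of \<open>P\<close> at the trace node.\<close>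
lemma face_trace_holds:
  assumes "valid_params p" and "(i, j) \<in> face_cells p ax" and "\<mu> \<in> nodes"
    and "\<forall>(i, j)\<in>cells p. \<forall>\<mu>\<in>nodes. \<forall>\<nu>\<in>nodes. P i j \<mu> \<nu>"
  shows "face_trace P \<sigma> ax i j \<mu>"
proof -
  have "1 \<in> nodes" "4 \<in> nodes" by (auto simp: nodes_def)
  \<comment> \<open>A boundary interface of the domain takes one of its traces from index 0 or
    \<open>ncells + 1\<close>, hence from the first ghost layer.\<close>
  moreover have "int (nghost p) \<ge> 1" using assms(1) by (auto simp: valid_params_def)
  ultimately show ?thesis using assms(2-4)
    by (cases \<sigma>; cases ax) (auto simp: face_cells_def cells_def)
qed

text \<open>The lower interface of an interior cell has index \<open>i - 1\<close> or
  \<open>j - 1\<close>, which is at least 0, so \<open>face_diff\<close> there reads indices in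
  \<open>face_cells\<close> only.\<close>

lemma face_diff_cong:
  assumes "(i, j) \<in> interior_cells p"
    and "\<And>\<sigma> k l. (k, l) \<in> face_cells p ax \<Longrightarrow> f \<sigma> k l = g \<sigma> k l"
  shows "face_diff ax f i j = face_diff ax g i j"
  using assms by (cases ax) (auto simp: face_cells_def interior_cells_def)

lemma face_diff_add:
  "face_diff ax (\<lambda>\<sigma> i j. f \<sigma> i j + g \<sigma> i j) i j = face_diff ax f i j + face_diff ax g i j"
  by (cases ax) auto

lemma face_diff_linear:
  assumes "linear F"
  shows "face_diff ax (\<lambda>\<sigma> i j. F (f \<sigma> i j)) i j = F (face_diff ax f i j)"
  using assms by (cases ax) (auto simp: linear_diff)

section \<open>The mesh-motion flux\<close>

text \<open>The speeds \<open>tmet\<close> and \<open>alpha\<close> come from the mesh data alone,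
  not from the transported field, so the flux is linear in that field.\<close>

lemma flux_transport_add:
  "flux_transport p D (\<lambda>i j \<mu> \<nu>. u i j \<mu> \<nu> + v i j \<mu> \<nu>) ax i j
     = flux_transport p D u ax i j + flux_transport p D v ax i j"
proof -
  have *: "face_trace (\<lambda>i j \<mu> \<nu>. u i j \<mu> \<nu> + v i j \<mu> \<nu>) \<sigma> ax i j \<mu>
      = face_trace u \<sigma> ax i j \<mu> + face_trace v \<sigma> ax i j \<mu>" for \<sigma> \<mu>
    by (cases \<sigma>; cases ax) auto
  show ?thesis
    unfolding flux_transport_def motion_flux_def avg_def jump_def *
    by (simp add: sum.distrib [symmetric] algebra_simps)
qed

lemma flux_transport_scaleR:
  "flux_transport p D (\<lambda>i j \<mu> \<nu>. c *\<^sub>R u i j \<mu> \<nu>) ax i j = c *\<^sub>R flux_transport p D u ax i j"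
proof -
  have *: "face_trace (\<lambda>i j \<mu> \<nu>. c *\<^sub>R u i j \<mu> \<nu>) \<sigma> ax i j \<mu> = c *\<^sub>R face_trace u \<sigma> ax i j \<mu>" for \<sigma> \<mu>
    by (cases \<sigma>; cases ax) auto
  show ?thesis
    unfolding flux_transport_def motion_flux_def avg_def jump_def *
    by (simp add: scaleR_sum_right algebra_simps)
qed

lemma rhs_transport_add:
  "rhs_transport p D (\<lambda>i j \<mu> \<nu>. u i j \<mu> \<nu> + v i j \<mu> \<nu>) i j
     = rhs_transport p D u i j + rhs_transport p D v i j"
  by (simp add: rhs_transport_def flux_transport_add face_diff_add algebra_simps)

lemma rhs_transport_scaleR:
  "rhs_transport p D (\<lambda>i j \<mu> \<nu>. c *\<^sub>R u i j \<mu> \<nu>) i j = c *\<^sub>R rhs_transport p D u i j"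
  by (simp add: rhs_transport_def flux_transport_scaleR face_diff_linear algebra_simps)

lemma rhs_transport_cong:
  assumes "valid_params p" and "(i, j) \<in> interior_cells p"
    and eq: "\<forall>(i, j)\<in>cells p. \<forall>\<mu>\<in>nodes. \<forall>\<nu>\<in>nodes. u i j \<mu> \<nu> = v i j \<mu> \<nu>"
  shows "rhs_transport p D u i j = rhs_transport p D v i j"
proof -
  \<comment> \<open>The hypothesis \<open>eq\<close> is itself a boolean nodal; its trace is the
    equality of the two traces.\<close>
  have trace: "face_trace u \<sigma> ax k l \<mu> = face_trace v \<sigma> ax k l \<mu>"
    if "(k, l) \<in> face_cells p ax" "\<mu> \<in> nodes" for \<sigma> ax k l \<mu>
    using face_trace_holds [OF assms(1) that eq, of \<sigma>] by (cases \<sigma>; cases ax) auto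
  have "flux_transport p D u ax k l = flux_transport p D v ax k l"
    if "(k, l) \<in> face_cells p ax" for ax k l
    unfolding flux_transport_def motion_flux_def avg_def jump_def
    by (intro sum.cong refl) (simp add: trace that)
  then have "face_diff ax (\<lambda>_. flux_transport p D u ax) i j
      = face_diff ax (\<lambda>_. flux_transport p D v ax) i j" for ax
    by (intro face_diff_cong [OF assms(2)]) auto
  then show ?thesis by (simp add: rhs_transport_def)
qed

text \<open>Equal traces have no jump and average \<open>c\<close>; what remains is the discrete
  geometric conservation law for \<open>J\<close>, scaled by \<open>c\<close>.\<close>

lemma rhs_transport_const:
  "rhs_transport p D (\<lambda>_ _ _ _. c) i j = rhs_J p D i j *\<^sub>R c"
proof -
  have trace: "face_trace (\<lambda>_ _ _ _. c) \<sigma> ax k l \<mu> = c" for \<sigma> ax k l \<mu>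
    by (cases \<sigma>; cases ax) auto
  have half: "(1 / 2) *\<^sub>R (c + c) = c"
    by (simp add: scaleR_2 [symmetric])
  have flux: "flux_transport p D (\<lambda>_ _ _ _. c) ax k l
      = (\<Sum>\<mu>\<in>nodes. weight \<mu> * tmet p D ax k l \<mu>) *\<^sub>R c" for ax k l
    by (simp only: flux_transport_def motion_flux_def avg_def jump_def trace half)
      (simp add: scaleR_sum_left)
  show ?thesis
    by (simp add: rhs_transport_def rhs_J_def flux diff_divide_distrib algebra_simps)
qed

section \<open>The balance of pressure and source at rest\<close>

definition momentum_vec :: "real^2 \<Rightarrow> real^3" where
  "momentum_vec n = vector [0, n $ 1, n $ 2]"

lemma linear_momentum_vec: "linear momentum_vec"
  by (auto simp: linear_iff momentum_vec_def vec_eq_iff forall_3 vector_3)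

text \<open>The normal is undefined (zero) where \<open>L = 0\<close>, but then the metric vanishes as well.\<close>
lemma Lmet_normal: "Lmet D ax i j \<mu> *\<^sub>R normal D ax i j \<mu> = metric D ax i j \<mu>"
proof (cases "Lmet D ax i j \<mu> = 0")
  case True
  then have "(metric D ax i j \<mu> $ 1)\<^sup>2 + (metric D ax i j \<mu> $ 2)\<^sup>2 = 0"
    by (simp add: Lmet_def sum_2)
  then have "metric D ax i j \<mu> = 0"
    by (simp add: vec_eq_iff forall_2 sum_power2_eq_zero_iff)
  then show ?thesis by (simp add: normal_def)
qed (simp add: normal_def)

text \<open>Pressure and source terms share the shape \<open>((0,c,0), (0,0,c))\<close>, so this one
  identity turns both into multiples of the metric.\<close>

lemma Lmet_pair_dot:
  "Lmet D ax i j \<mu> *\<^sub>R pair_dot (normal D ax i j \<mu>) (vector [0, c, 0], vector [0, 0, c])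
     = c *\<^sub>R momentum_vec (metric D ax i j \<mu>)"
  unfolding Lmet_normal [symmetric, of D ax i j \<mu>]
  by (simp add: pair_dot_def momentum_vec_def vec_eq_iff forall_3 vector_3)

text \<open>Equal levels give equal reconstructed depths, so the \<open>beta\<close> dissipation
  vanishes, and \<open>hr_correction\<close> replaces the common pressure at that depth by the
  pressure of the inside trace.\<close>

lemma Fn_tilde_at_rest:
  assumes rest: "\<And>\<sigma>. face_trace (h_nd D) \<sigma> ax i j \<mu> + face_trace (b_nd D) \<sigma> ax i j \<mu> = C"
    and vel: "\<And>\<sigma>. face_trace (v_nd p D 2) \<sigma> ax i j \<mu> = 0"
      "\<And>\<sigma>. face_trace (v_nd p D 3) \<sigma> ax i j \<mu> = 0"
  shows "Lmet D ax i j \<mu> *\<^sub>R Fn_tilde p D S \<sigma> ax i j \<mu>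
    = (grav p / 2 * (face_trace (h_nd D) \<sigma> ax i j \<mu>)\<^sup>2) *\<^sub>R momentum_vec (metric D ax i j \<mu>)"
proof -
  define H where "H = h_star D Plus ax i j \<mu>"
  have h_star: "h_star D \<tau> ax i j \<mu> = H" for \<tau>
    by (simp add: H_def h_star_def rest)
  have "F1_tilde p D \<sigma> ax i j \<mu> = vector [0, grav p / 2 * (face_trace (h_nd D) \<sigma> ax i j \<mu>)\<^sup>2, 0]"
    "F2_tilde p D \<sigma> ax i j \<mu> = vector [0, 0, grav p / 2 * (face_trace (h_nd D) \<sigma> ax i j \<mu>)\<^sup>2]"
    by (simp_all add: F1_tilde_def F2_tilde_def at_star_def hr_correction_def F1_def F2_def
        h_star vel vec_eq_iff forall_3 vector_3)
  then show ?thesis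
    by (simp add: Fn_tilde_def at_star_def h_star vel Lmet_pair_dot)
qed

definition metric_flux :: "stage_data \<Rightarrow> axis \<Rightarrow> int \<Rightarrow> int \<Rightarrow> real^2" where
  "metric_flux D ax i j = (\<Sum>\<mu>\<in>nodes. weight \<mu> *\<^sub>R metric D ax i j \<mu>)"

lemma metric_flux_conservation:
  assumes "surface_conservation_laws p D" and "(i, j) \<in> interior_cells p"
  shows "(\<Sum>ax\<in>{Xi1, Xi2}. (1 / dxi p ax) *\<^sub>R face_diff ax (\<lambda>_. metric_flux D ax) i j) = 0"
proof -
  have "linear (\<lambda>x::real^2. x $ k)" for k
    by (simp add: linear_iff)
  from face_diff_linear [OF this, symmetric]
  have "(face_diff ax (\<lambda>_. metric_flux D ax) i j) $ k
      = face_diff ax (\<lambda>_ i j. \<Sum>\<mu>\<in>nodes. weight \<mu> * metric D ax i j \<mu> $ k) i j" for ax k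
    by (simp add: metric_flux_def)
  then show ?thesis
    using assms by (auto simp: surface_conservation_laws_def vec_eq_iff simp del: sum.insert)
qed

text \<open>The square \<open>(C - b)^2\<close> is expanded so that the coefficients of the two
  source fluxes are the values of \<open>s_bar\<close> at rest. Of the pressure, only the
  \<open>C^2\<close> term is the same from both sides.\<close>

lemma flux_U_at_rest:
  assumes rest: "\<And>\<sigma> \<mu>. \<mu> \<in> nodes \<Longrightarrow>
      face_trace (h_nd D) \<sigma> ax i j \<mu> + face_trace (b_nd D) \<sigma> ax i j \<mu> = C"
    and vel: "\<And>\<sigma> \<mu>. \<mu> \<in> nodes \<Longrightarrow> face_trace (v_nd p D 2) \<sigma> ax i j \<mu> = 0"
      "\<And>\<sigma> \<mu>. \<mu> \<in> nodes \<Longrightarrow> face_trace (v_nd p D 3) \<sigma> ax i j \<mu> = 0"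
  shows "flux_U p D S ax \<sigma> i j
    = flux_transport p D (U_nd D) ax i j
      + (- (grav p * C) *\<^sub>R flux_R D 1 ax \<sigma> i j + (grav p / 2) *\<^sub>R flux_R D 2 ax \<sigma> i j)
      + (grav p / 2 * C\<^sup>2) *\<^sub>R momentum_vec (metric_flux D ax i j)"
proof -
  let ?m = "\<lambda>\<mu>. momentum_vec (metric D ax i j \<mu>)"
  let ?b = "\<lambda>\<mu>. face_trace (b_nd D) \<sigma> ax i j \<mu>"
  have U: "flux_U p D S ax \<sigma> i j = (\<Sum>\<mu>\<in>nodes. weight \<mu> *\<^sub>R
      (motion_flux p D (U_nd D) ax i j \<mu> + (grav p / 2 * (C - ?b \<mu>)\<^sup>2) *\<^sub>R ?m \<mu>))"
    unfolding flux_U_def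
  proof (intro sum.cong refl)
    fix \<mu> assume \<mu>: "\<mu> \<in> nodes"
    have "face_trace (h_nd D) \<sigma> ax i j \<mu> = C - ?b \<mu>"
      using rest [OF \<mu>, of \<sigma>] by simp
    then show "weight \<mu> *\<^sub>R (motion_flux p D (U_nd D) ax i j \<mu>
          + Lmet D ax i j \<mu> *\<^sub>R Fn_tilde p D S \<sigma> ax i j \<mu>)
        = weight \<mu> *\<^sub>R (motion_flux p D (U_nd D) ax i j \<mu>
          + (grav p / 2 * (C - ?b \<mu>)\<^sup>2) *\<^sub>R ?m \<mu>)"
      by (simp add: Fn_tilde_at_rest [OF rest [OF \<mu>] vel(1) [OF \<mu>] vel(2) [OF \<mu>]])
  qed
  have R: "flux_R D m ax \<sigma> i j = (\<Sum>\<mu>\<in>nodes. (weight \<mu> * ?b \<mu> ^ m) *\<^sub>R ?m \<mu>)" for m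
    unfolding flux_R_def r_vec_def scaleR_scaleR [symmetric] Lmet_pair_dot ..
  have M: "momentum_vec (metric_flux D ax i j) = (\<Sum>\<mu>\<in>nodes. weight \<mu> *\<^sub>R ?m \<mu>)"
    by (simp add: metric_flux_def linear_sum [OF linear_momentum_vec]
        linear_cmul [OF linear_momentum_vec])
  show ?thesis
    unfolding U R M flux_transport_def scaleR_sum_right sum.distrib [symmetric]
    by (intro sum.cong refl)
      (simp add: vec_eq_iff power2_eq_square field_simps)
qed

lemma rhs_JU_at_rest:
  assumes p: "valid_params p" and scl: "surface_conservation_laws p D"
    and ij: "(i, j) \<in> interior_cells p"
    and level: "U_bar (S i j) + w_bar (S i j) = C *\<^sub>R e1"
    and nodes_level: "\<forall>(i, j)\<in>cells p. \<forall>\<mu>\<in>nodes. \<forall>\<nu>\<in>nodes.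
      U_nd D i j \<mu> \<nu> + w_nd D i j \<mu> \<nu> = C *\<^sub>R e1"
  shows "rhs_JU p D S i j = rhs_transport p D (U_nd D) i j"
proof -
  \<comment> \<open>Zero momentum gives zero velocity in both branches of \<open>vel\<close>, so dry
    nodes are covered. The facts form one conjunction so that they pass to the traces
    together.\<close>
  have comp: "\<forall>(i, j)\<in>cells p. \<forall>\<mu>\<in>nodes. \<forall>\<nu>\<in>nodes.
      h_nd D i j \<mu> \<nu> + b_nd D i j \<mu> \<nu> = C \<and> v_nd p D 2 i j \<mu> \<nu> = 0 \<and> v_nd p D 3 i j \<mu> \<nu> = 0"
    using nodes_level
    by (auto simp: v_nd_def h_nd_def w_nd_def vel_def e1_def vec_eq_iff forall_3 vector_3)
  have rest: "face_trace (h_nd D) \<sigma> ax k l \<mu> + face_trace (b_nd D) \<sigma> ax k l \<mu> = C"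
    and v2: "face_trace (v_nd p D 2) \<sigma> ax k l \<mu> = 0"
    and v3: "face_trace (v_nd p D 3) \<sigma> ax k l \<mu> = 0"
    if "(k, l) \<in> face_cells p ax" "\<mu> \<in> nodes" for \<sigma> ax k l \<mu>
    using face_trace_holds [OF p that comp, of \<sigma>] by (cases \<sigma>; cases ax; simp)+
  have s_bar: "s_bar p S 1 i j = - (grav p * C)" "s_bar p S 2 i j = grav p / 2"
    using level by (simp_all add: s_bar_def s_coef_def e1_def vec_eq_iff forall_3 vector_3)
  have "s_nd p D m i j \<mu> \<nu> = s_bar p S m i j"
    if "m \<in> {1, 2}" "\<mu> \<in> nodes" "\<nu> \<in> nodes" for m \<mu> \<nu>
  proof -
    have "(i, j) \<in> cells p"
      using ij interior_subset_cells by blast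
    then have "h_nd D i j \<mu> \<nu> + b_nd D i j \<mu> \<nu> = C"
      using comp that by fastforce
    then show ?thesis
      using that s_bar by (auto simp: s_nd_def s_coef_def)
  qed
  \<comment> \<open>Both source coefficients are constant at rest, so every factor in front of
    \<open>div_r\<close> is zero.\<close>
  then have vol: "(\<Sum>\<mu>\<in>nodes. \<Sum>\<nu>\<in>nodes. (weight \<mu> * weight \<nu>) *\<^sub>R
      (\<Sum>m\<in>{1, 2}. (s_nd p D m i j \<mu> \<nu> - s_bar p S m i j) *\<^sub>R div_r D m i j \<mu> \<nu>)) = 0"
    by (intro sum.neutral ballI) simp
  let ?M = "\<lambda>ax. face_diff ax (\<lambda>_. metric_flux D ax) i j"
  let ?R = "\<lambda>m ax. face_diff ax (flux_R D m ax) i j"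
  have flux: "face_diff ax (flux_U p D S ax) i j
      = face_diff ax (\<lambda>_. flux_transport p D (U_nd D) ax) i j
        + (- (grav p * C) *\<^sub>R ?R 1 ax + (grav p / 2) *\<^sub>R ?R 2 ax)
        + (grav p / 2 * C\<^sup>2) *\<^sub>R momentum_vec (?M ax)" for ax
  proof -
    have "face_diff ax (flux_U p D S ax) i j
      = face_diff ax (\<lambda>\<sigma> i j. flux_transport p D (U_nd D) ax i j
          + (- (grav p * C) *\<^sub>R flux_R D 1 ax \<sigma> i j + (grav p / 2) *\<^sub>R flux_R D 2 ax \<sigma> i j)
          + (grav p / 2 * C\<^sup>2) *\<^sub>R momentum_vec (metric_flux D ax i j)) i j"
      by (intro face_diff_cong [OF ij] flux_U_at_rest rest v2 v3)
    then show ?thesis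
      by (simp only: face_diff_add face_diff_linear [OF linear_scaleR]
          face_diff_linear [OF linear_momentum_vec])
  qed
  have src: "(\<Sum>m\<in>{1, 2}. s_bar p S m i j *\<^sub>R ?R m ax)
      = - (grav p * C) *\<^sub>R ?R 1 ax + (grav p / 2) *\<^sub>R ?R 2 ax" for ax
    using s_bar by simp
  \<comment> \<open>The source fluxes cancel between \<open>flux\<close> and \<open>src\<close>; the
    remainder is the image of the discrete metric divergence under one linear map.\<close>
  have "rhs_JU p D S i j = rhs_transport p D (U_nd D) i j
      - (grav p / 2 * C\<^sup>2) *\<^sub>R momentum_vec (\<Sum>ax\<in>{Xi1, Xi2}. (1 / dxi p ax) *\<^sub>R ?M ax)"
    unfolding rhs_JU_def vol flux src rhs_transport_def
      linear_sum [OF linear_momentum_vec] linear_cmul [OF linear_momentum_vec]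
    by (simp add: algebra_simps del: face_diff.simps)
  then show ?thesis
    by (simp only: metric_flux_conservation [OF scl ij] linear_0 [OF linear_momentum_vec]) simp
qed

section \<open>Linear invariants of a time step\<close>

text \<open>A stage combines all earlier stages, hence strong induction. Linearity settles the
  interior cells; \<open>ghost\<close> then extends the result to all cells, as the premise of
  \<open>rhs\<close> requires at the next stage.\<close>

lemma time_step_invariant:
  fixes f :: "cell_avg \<Rightarrow> 'a::real_vector"
  assumes "linear f" and "time_step p T dt D Y"
    and init: "\<forall>(i, j)\<in>cells p. f (Y 0 i j) = 0"
    and rhs: "\<And>k i j. \<lbrakk>k < num_stages T; \<forall>(i, j)\<in>cells p. f (Y k i j) = 0; (i, j) \<in> interior_cells p\<rbrakk>
      \<Longrightarrow> f (rhs p (D k) (Y k) i j) = 0"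
    and ghost: "\<And>k. \<lbrakk>k \<le> num_stages T; \<forall>(i, j)\<in>interior_cells p. f (Y k i j) = 0\<rbrakk>
      \<Longrightarrow> \<forall>(i, j)\<in>cells p. f (Y k i j) = 0"
    and "k \<le> num_stages T"
  shows "\<forall>(i, j)\<in>cells p. f (Y k i j) = 0"
  using \<open>k \<le> num_stages T\<close>
proof (induction k rule: less_induct)
  case (less m)
  show ?case
  proof (cases "m = 0")
    case False
    have prev: "f (Y k i j) = 0" "f (rhs p (D k) (Y k) i j) = 0"
      if "k < m" "(i, j) \<in> interior_cells p" for k i j
      using less that rhs [of k i j] interior_subset_cells [of p] by force+
    have "f (Y m i j) = 0" if ij: "(i, j) \<in> interior_cells p" for i j
    proof (cases T)
      case Forward_Euler
      then have "m = 1" using False less.prems by simp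
      then have "Y m i j = Y 0 i j + dt *\<^sub>R rhs p (D 0) (Y 0) i j"
        using assms(2) Forward_Euler ij by auto
      then show ?thesis
        using prev [of 0 i j] ij \<open>m = 1\<close>
        by (simp add: linear_add [OF \<open>linear f\<close>] linear_cmul [OF \<open>linear f\<close>])
    next
      case (SSP_RK s a c)
      then have "m \<in> {1..s}" using False less.prems by simp
      then have "Y m i j = (\<Sum>k<m. a m k *\<^sub>R Y k i j + (dt * c m k) *\<^sub>R rhs p (D k) (Y k) i j)"
        using assms(2) SSP_RK ij by auto
      then show ?thesis
        using prev ij
        by (simp add: linear_sum [OF \<open>linear f\<close>] linear_add [OF \<open>linear f\<close>]
            linear_cmul [OF \<open>linear f\<close>])
    qed
    then show ?thesis using ghost [OF less.prems] by auto
  qed (simp add: init)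
qed

text \<open>The integrator acts linearly on the \<open>J\<close>-weighted averages, whereas
  \<open>q_bar\<close> is a quotient. Multiplying by \<open>J_bar\<close> makes the condition
  linear; \<open>rest_defect\<close> does the same for the steady state.\<close>

definition q_defect :: "cell_avg \<Rightarrow> real^3" where
  "q_defect a = Jq_bar a - J_bar a *\<^sub>R e1"

definition rest_defect :: "real \<Rightarrow> cell_avg \<Rightarrow> real^3" where
  "rest_defect C a = JU_bar a + Jw_bar a - C *\<^sub>R Jq_bar a"

lemma linear_q_defect: "linear q_defect"
  by (auto simp: linear_iff q_defect_def Jq_bar_def J_bar_def algebra_simps)

lemma linear_rest_defect: "linear (rest_defect C)"
  by (auto simp: linear_iff rest_defect_def JU_bar_def Jw_bar_def Jq_bar_def algebra_simps)

lemma q_defect_eq_0_iff: "J_bar a > 0 \<Longrightarrow> q_defect a = 0 \<longleftrightarrow> q_bar a = e1"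
  by (auto simp: q_defect_def q_bar_def vec_eq_iff field_simps)

lemma rest_defect_eq_0_iff:
  assumes "J_bar a > 0"
  shows "rest_defect C a = 0 \<longleftrightarrow> U_bar a + w_bar a = C *\<^sub>R q_bar a"
proof -
  have "U_bar a + w_bar a - C *\<^sub>R q_bar a = (1 / J_bar a) *\<^sub>R rest_defect C a"
    by (simp add: rest_defect_def U_bar_def w_bar_def q_bar_def algebra_simps)
  with assms show ?thesis
    by (metis divide_eq_0_iff less_irrefl right_minus_eq scaleR_eq_0_iff zero_neq_one)
qed

section \<open>Defects in ghost cells and under the right-hand side\<close>

lemma cells_cases: "(i, j) \<in> cells p \<Longrightarrow> (i, j) \<in> interior_cells p \<or> (i, j) \<in> ghost_cells p"
  by (auto simp: ghost_cells_def)

lemma ghost_subset_cells: "ghost_cells p \<subseteq> cells p"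
  by (auto simp: ghost_cells_def)

lemma q_defect_ghost:
  assumes "positive_J p S" and "compatible_ghost_values p S"
    and "\<forall>(i, j)\<in>interior_cells p. q_defect (S i j) = 0"
  shows "\<forall>(i, j)\<in>cells p. q_defect (S i j) = 0"
proof -
  have J: "q_defect (S i j) = 0 \<longleftrightarrow> q_bar (S i j) = e1" if "(i, j) \<in> cells p" for i j
    using assms(1) that by (intro q_defect_eq_0_iff) (auto simp: positive_J_def)
  have "\<forall>(i, j)\<in>interior_cells p. q_bar (S i j) = e1"
    using assms(3) J interior_subset_cells [of p] by blast
  then have "\<forall>(i, j)\<in>ghost_cells p. q_bar (S i j) = e1"
    using assms(2) by (auto simp: compatible_ghost_values_def)
  then show ?thesis
    using assms(3) J ghost_subset_cells [of p] by (fastforce dest: cells_cases)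
qed

lemma rest_defect_ghost:
  assumes "positive_J p S" and "compatible_ghost_values p S"
    and "\<forall>(i, j)\<in>interior_cells p. rest_defect C (S i j) = 0"
  shows "\<forall>(i, j)\<in>cells p. rest_defect C (S i j) = 0"
proof -
  have J: "rest_defect C (S i j) = 0 \<longleftrightarrow> U_bar (S i j) + w_bar (S i j) = C *\<^sub>R q_bar (S i j)"
    if "(i, j) \<in> cells p" for i j
    using assms(1) that by (intro rest_defect_eq_0_iff) (auto simp: positive_J_def)
  have "\<forall>(i, j)\<in>interior_cells p. U_bar (S i j) + w_bar (S i j) = C *\<^sub>R q_bar (S i j)"
    using assms(3) J interior_subset_cells [of p] by blast
  then have "\<forall>(i, j)\<in>ghost_cells p. U_bar (S i j) + w_bar (S i j) = C *\<^sub>R q_bar (S i j)"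
    using assms(2) unfolding compatible_ghost_values_def by blast
  then show ?thesis
    using assms(3) J ghost_subset_cells [of p] by (fastforce dest: cells_cases)
qed

lemma q_nd_eq_e1:
  assumes "positive_J p S" and "admissible_stage p D S"
    and "\<forall>(i, j)\<in>cells p. q_defect (S i j) = 0"
  shows "\<forall>(i, j)\<in>cells p. \<forall>\<mu>\<in>nodes. \<forall>\<nu>\<in>nodes. q_nd D i j \<mu> \<nu> = e1"
proof -
  have "\<forall>(i, j)\<in>cells p. q_bar (S i j) = e1"
    using assms(1,3) by (fastforce simp: positive_J_def q_defect_eq_0_iff)
  then show ?thesis
    using assms(2) unfolding admissible_stage_def constant_preserving_reconstruction_def by blast
qed

text \<open>Transporting the constant \<open>e1\<close> yields the increment of \<open>J\<close>
  times \<open>e1\<close>, so both terms of the defect change alike.\<close>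

lemma q_defect_rhs:
  assumes "valid_params p" and "positive_J p S" and "admissible_stage p D S"
    and "\<forall>(i, j)\<in>cells p. q_defect (S i j) = 0" and "(i, j) \<in> interior_cells p"
  shows "q_defect (rhs p D S i j) = 0"
  using rhs_transport_cong [OF assms(1,5) q_nd_eq_e1 [OF assms(2-4)], of D]
  by (simp add: q_defect_def rhs_def Jq_bar_def J_bar_def rhs_transport_const)

text \<open>The vanishing of \<open>q_defect\<close> turns the level \<open>C q\<close> into the
  true constant \<open>C e1\<close>, on which the pressure balance rests.\<close>

lemma rest_defect_rhs:
  assumes "valid_params p" and "positive_J p S" and "admissible_stage p D S"
    and "\<forall>(i, j)\<in>cells p. q_defect (S i j) = 0"
    and "\<forall>(i, j)\<in>cells p. rest_defect C (S i j) = 0" and "(i, j) \<in> interior_cells p"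
  shows "rest_defect C (rhs p D S i j) = 0"
proof -
  have level: "\<forall>(i, j)\<in>cells p. U_bar (S i j) + w_bar (S i j) = C *\<^sub>R q_bar (S i j)"
    using assms(2,5) by (fastforce simp: positive_J_def rest_defect_eq_0_iff)
  have nodes_q: "\<forall>(i, j)\<in>cells p. \<forall>\<mu>\<in>nodes. \<forall>\<nu>\<in>nodes.
      U_nd D i j \<mu> \<nu> + w_nd D i j \<mu> \<nu> = C *\<^sub>R q_nd D i j \<mu> \<nu>"
    using level assms(3)
    unfolding admissible_stage_def steady_preserving_reconstruction_def by blast
  then have nodes_e1: "\<forall>(i, j)\<in>cells p. \<forall>\<mu>\<in>nodes. \<forall>\<nu>\<in>nodes.
      U_nd D i j \<mu> \<nu> + w_nd D i j \<mu> \<nu> = C *\<^sub>R e1"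
    using q_nd_eq_e1 [OF assms(2-4)] by fastforce
  have cell: "(i, j) \<in> cells p"
    using assms(6) interior_subset_cells by blast
  then have "J_bar (S i j) > 0" and "q_defect (S i j) = 0"
    using assms(2,4) by (auto simp: positive_J_def)
  then have "U_bar (S i j) + w_bar (S i j) = C *\<^sub>R e1"
    using level cell by (auto simp: q_defect_eq_0_iff)
  moreover have "surface_conservation_laws p D"
    using assms(3) by (simp add: admissible_stage_def)
  ultimately have "rhs_JU p D S i j = rhs_transport p D (U_nd D) i j"
    using rhs_JU_at_rest assms(1,6) nodes_e1 by blast
  \<comment> \<open>All three fields now evolve by the same linear transport, and
    \<open>U + w\<close> agrees with \<open>C q\<close> at every node.\<close>
  then show ?thesis
    using rhs_transport_cong [OF assms(1,6) nodes_q, of D]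
    by (simp add: rest_defect_def rhs_def JU_bar_def Jw_bar_def Jq_bar_def
        rhs_transport_add rhs_transport_scaleR)
qed

theorem theorem4p1:
  fixes p :: params and T :: time_integrator and dt :: "nat \<Rightarrow> real"
    and D :: "nat \<Rightarrow> nat \<Rightarrow> stage_data" and Y :: "nat \<Rightarrow> nat \<Rightarrow> state"
    and S :: "nat \<Rightarrow> state" and n :: nat and C :: real
  assumes "valid_params p"
    and "valid_integrator T"
    and "numerical_solution p T dt D Y S n"
    and "\<forall>(i, j)\<in>cells p. U_bar (S n i j) + w_bar (S n i j) = C *\<^sub>R q_bar (S n i j)"
  shows "\<forall>(i, j)\<in>cells p.
    U_bar (S (Suc n) i j) + w_bar (S (Suc n) i j) = C *\<^sub>R q_bar (S (Suc n) i j)"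
proof -
  have q0: "\<forall>(i, j)\<in>cells p. q_bar (S 0 i j) = e1"
    using assms(3) by (simp add: numerical_solution_def)
  have step: "Y m 0 = S m" "Y m (num_stages T) = S (Suc m)" "time_step p T (dt m) (D m) (Y m)"
    if "m \<le> n" for m
    using assms(3) that by (auto simp: numerical_solution_def)
  have pos: "positive_J p (Y m k)" and ghost: "compatible_ghost_values p (Y m k)"
    if "m \<le> n" "k \<le> num_stages T" for m k
    using assms(3) that by (auto simp: numerical_solution_def)
  have adm: "admissible_stage p (D m k) (Y m k)" if "m \<le> n" "k < num_stages T" for m k
    using assms(3) that by (auto simp: numerical_solution_def)
  have q_stages: "\<forall>(i, j)\<in>cells p. q_defect (Y m k i j) = 0"
    if "m \<le> n" "k \<le> num_stages T" "\<forall>(i, j)\<in>cells p. q_defect (S m i j) = 0" for m k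
  proof (rule time_step_invariant [OF linear_q_defect step(3) [OF \<open>m \<le> n\<close>]])
    show "\<forall>(i, j)\<in>cells p. q_defect (Y m 0 i j) = 0"
      using that step by simp
  next
    fix l i j
    assume "l < num_stages T" "\<forall>(i, j)\<in>cells p. q_defect (Y m l i j) = 0"
      "(i, j) \<in> interior_cells p"
    then show "q_defect (rhs p (D m l) (Y m l) i j) = 0"
      using q_defect_rhs assms(1) pos adm that(1) by simp
  next
    fix l
    assume "l \<le> num_stages T" "\<forall>(i, j)\<in>interior_cells p. q_defect (Y m l i j) = 0"
    then show "\<forall>(i, j)\<in>cells p. q_defect (Y m l i j) = 0"
      using q_defect_ghost pos ghost that(1) by blast
  qed (fact that(2))
  \<comment> \<open>The value of \<open>q\<close> is prescribed at level 0 only and has to be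
    carried through all steps up to level \<open>n\<close>.\<close>
  have q_levels: "\<forall>(i, j)\<in>cells p. q_defect (S m i j) = 0" if "m \<le> n" for m
    using that
  proof (induction m)
    case 0
    then show ?case
      using q0 pos [of 0 0] step(1) [of 0] by (fastforce simp: positive_J_def q_defect_eq_0_iff)
  next
    case (Suc m)
    then show ?case
      using q_stages [of m "num_stages T"] step(2) [of m] by simp
  qed
  \<comment> \<open>The steady state is followed through step \<open>n\<close> alone, with
    \<open>q_stages\<close> supplying the value of \<open>q\<close> at each of its stages.\<close>
  have "\<forall>(i, j)\<in>cells p. rest_defect C (Y n (num_stages T) i j) = 0"
  proof (rule time_step_invariant [OF linear_rest_defect step(3) [OF order_refl]])
    show "\<forall>(i, j)\<in>cells p. rest_defect C (Y n 0 i j) = 0"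
      using assms(4) pos [of n 0] step(1) [of n] by (fastforce simp: positive_J_def rest_defect_eq_0_iff)
  next
    fix l i j
    assume "l < num_stages T" "\<forall>(i, j)\<in>cells p. rest_defect C (Y n l i j) = 0"
      "(i, j) \<in> interior_cells p"
    then show "rest_defect C (rhs p (D n l) (Y n l) i j) = 0"
      using rest_defect_rhs assms(1) pos adm q_stages q_levels by simp
  next
    fix l
    assume "l \<le> num_stages T" "\<forall>(i, j)\<in>interior_cells p. rest_defect C (Y n l i j) = 0"
    then show "\<forall>(i, j)\<in>cells p. rest_defect C (Y n l i j) = 0"
      using rest_defect_ghost pos ghost by blast
  qed simp
  then show ?thesis
    using pos [of n "num_stages T"] step(2) [of n]
    by (fastforce simp: positive_J_def rest_defect_eq_0_iff)
qed

end
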